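(* Let $\mathcal{A}$ and $\mathcal{B}$ be two finite categories. Then $$\chi(\mathcal{A}\times\mathcal{B})=\chi(\mathcal{A})\,\chi(\mathcal{B}),$$ where $\mathcal{A}\times\mathcal{B}$ is the product category.
   Context: A finite category is a category with finitely many objects and finitely many morphisms. All matrices have entries in $\mathbb{Q}$, and $M^*$ denotes the transpose of $M$. The Moore–Penrose inverse of an $m\times n$-matrix $M$ is the unique $n\times m$-matrix $M^+$ satisfying $MM^+M=M$, $M^+MM^+=M^+$, $(M^+M)^*=M^+M$, $(MM^+)^*=MM^+$. $\mathbf{1}_m$ denotes the $m\times 1$-matrix all of whose entries are $1$. For a finite category $\mathcal{A}$ with object set $\{a_1,\dots,a_m\}$, $|\mathcal{A}|=m$ is the number of objects and $[\mathcal{A}]$ is the $m\times m$-matrix whose $ij$-th entry is the number of elements of the morphism set $\mathcal{A}(a_i,a_j)$. Define $\chi(\mathcal{A})=\mathbf{1}_{|\mathcal{A}|}^*[\mathcal{A}]^+\mathbf{1}_{|\mathcal{A}|}$, a $1\times 1$-matrix regarded as a rational number (it does not depend on the chosen order of the objects). *)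

theory Defs
  imports "Jordan_Normal_Form.Matrix"
begin

(* Categories in the single-sorted style: the hom-sets are obtained from the sources
   and targets of the morphisms.  compos C g f is "g after f", constrained only
   if src C g = tgt C f; nothing is assumed about the fields outside obs and mors. *)
record ('o, 'm) cat_struct =
  obs :: "'o set"
  mors :: "'m set"
  src :: "'m \<Rightarrow> 'o"
  tgt :: "'m \<Rightarrow> 'o"
  ident :: "'o \<Rightarrow> 'm"
  compos :: "'m \<Rightarrow> 'm \<Rightarrow> 'm"

definition homset :: "('o, 'm) cat_struct \<Rightarrow> 'o \<Rightarrow> 'o \<Rightarrow> 'm set" where
  "homset C a b = {f \<in> mors C. src C f = a \<and> tgt C f = b}"

locale category =
  fixes C :: "('o, 'm) cat_struct"
  assumes src_in_obs: "f \<in> mors C \<Longrightarrow> src C f \<in> obs C"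
    and tgt_in_obs: "f \<in> mors C \<Longrightarrow> tgt C f \<in> obs C"
    and ident_in_homset: "a \<in> obs C \<Longrightarrow> ident C a \<in> homset C a a"
    and compos_in_homset:
      "\<lbrakk>f \<in> homset C a b; g \<in> homset C b c\<rbrakk> \<Longrightarrow> compos C g f \<in> homset C a c"
    and compos_ident_right: "f \<in> homset C a b \<Longrightarrow> compos C f (ident C a) = f"
    and compos_ident_left: "f \<in> homset C a b \<Longrightarrow> compos C (ident C b) f = f"
    and compos_assoc:
      "\<lbrakk>f \<in> homset C a b; g \<in> homset C b c; h \<in> homset C c d\<rbrakk>
        \<Longrightarrow> compos C h (compos C g f) = compos C (compos C h g) f"

locale finite_category = category +
  assumes finite_obs: "finite (obs C)"
    and finite_mors: "finite (mors C)"

definition prod_cat ::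
  "('o1, 'm1) cat_struct \<Rightarrow> ('o2, 'm2) cat_struct \<Rightarrow> ('o1 \<times> 'o2, 'm1 \<times> 'm2) cat_struct" where
  "prod_cat C D =
    \<lparr>obs = obs C \<times> obs D,
     mors = mors C \<times> mors D,
     src = map_prod (src C) (src D),
     tgt = map_prod (tgt C) (tgt D),
     ident = map_prod (ident C) (ident D),
     compos = (\<lambda>g f. (compos C (fst g) (fst f), compos D (snd g) (snd f)))\<rparr>"

lemma homset_prod_cat:
  "homset (prod_cat C D) a b = homset C (fst a) (fst b) \<times> homset D (snd a) (snd b)"
  by (cases a; cases b) (auto simp: homset_def prod_cat_def)

lemma finite_category_prod_cat:
  assumes "finite_category C" and "finite_category D"
  shows "finite_category (prod_cat C D)"
proof -
  interpret C: finite_category C by fact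
  interpret D: finite_category D by fact
  show ?thesis
  proof
    show "finite (obs (prod_cat C D))" "finite (mors (prod_cat C D))"
      using C.finite_obs D.finite_obs C.finite_mors D.finite_mors
      by (simp_all add: prod_cat_def)
  next
    fix f assume "f \<in> mors (prod_cat C D)"
    then show "src (prod_cat C D) f \<in> obs (prod_cat C D)"
      and "tgt (prod_cat C D) f \<in> obs (prod_cat C D)"
      by (auto simp: prod_cat_def C.src_in_obs D.src_in_obs C.tgt_in_obs D.tgt_in_obs)
  next
    fix a assume "a \<in> obs (prod_cat C D)"
    then show "ident (prod_cat C D) a \<in> homset (prod_cat C D) a a"
      unfolding homset_prod_cat
      by (auto simp: prod_cat_def C.ident_in_homset D.ident_in_homset)
  next
    fix f g a b c
    assume "f \<in> homset (prod_cat C D) a b" "g \<in> homset (prod_cat C D) b c"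
    then show "compos (prod_cat C D) g f \<in> homset (prod_cat C D) a c"
      unfolding homset_prod_cat
      by (auto simp: prod_cat_def intro: C.compos_in_homset D.compos_in_homset)
  next
    fix f a b assume "f \<in> homset (prod_cat C D) a b"
    then show "compos (prod_cat C D) f (ident (prod_cat C D) a) = f"
      and "compos (prod_cat C D) (ident (prod_cat C D) b) f = f"
      unfolding homset_prod_cat
      by (auto simp: prod_cat_def C.compos_ident_right D.compos_ident_right
          C.compos_ident_left D.compos_ident_left)
  next
    fix f g h a b c d
    assume "f \<in> homset (prod_cat C D) a b" "g \<in> homset (prod_cat C D) b c"
      "h \<in> homset (prod_cat C D) c d"
    then show "compos (prod_cat C D) h (compos (prod_cat C D) g f)
        = compos (prod_cat C D) (compos (prod_cat C D) h g) f"
      unfolding homset_prod_cat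
      by (auto simp: prod_cat_def intro: C.compos_assoc D.compos_assoc)
  qed
qed

definition is_mp_inverse :: "rat mat \<Rightarrow> rat mat \<Rightarrow> bool" where
  "is_mp_inverse M N \<longleftrightarrow>
     N \<in> carrier_mat (dim_col M) (dim_row M) \<and>
     M * N * M = M \<and>
     N * M * N = N \<and>
     transpose_mat (N * M) = N * M \<and>
     transpose_mat (M * N) = M * N"

definition mp_inverse :: "rat mat \<Rightarrow> rat mat" where
  "mp_inverse M = (THE N. is_mp_inverse M N)"

definition ones_mat :: "nat \<Rightarrow> rat mat" where
  "ones_mat m = mat m 1 (\<lambda>_. 1)"

(* An arbitrary ordering of the objects; the value of euler_char does not depend on it. *)
definition obj_enum :: "('o, 'm) cat_struct \<Rightarrow> 'o list" where
  "obj_enum C = (SOME as. distinct as \<and> set as = obs C)"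

definition hom_mat :: "('o, 'm) cat_struct \<Rightarrow> rat mat" where
  "hom_mat C = mat (card (obs C)) (card (obs C))
     (\<lambda>(i, j). of_nat (card (homset C (obj_enum C ! i) (obj_enum C ! j))))"

(* The matrix product below is 1 x 1; it is identified with its only entry. *)
definition euler_char :: "('o, 'm) cat_struct \<Rightarrow> rat" where
  "euler_char C =
     (transpose_mat (ones_mat (card (obs C))) * mp_inverse (hom_mat C)
        * ones_mat (card (obs C))) $$ (0, 0)"

end

theory Submission
  imports Defs "HOL-Library.Function_Algebras"
begin

text \<open>
  A hom-set of the product category is the product of two
  hom-sets of the factors, so the matrix of the product category is the Kronecker product of the
  two matrices.  The Kronecker product is multiplicative and compatible with transposition, hence
  the four Penrose equations for \<open>(M, M\<^sup>+)\<close> and \<open>(N, N\<^sup>+)\<close> multiply to those for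
  \<open>M \<otimes> N\<close> and \<open>M\<^sup>+ \<otimes> N\<^sup>+\<close>; by uniqueness of the Moore--Penrose inverse,
  \<open>(M \<otimes> N)\<^sup>+ = M\<^sup>+ \<otimes> N\<^sup>+\<close>.  Finally \<open>\<chi>\<close> is the sum of all entries of the
  Moore--Penrose inverse, and the sum of the entries of a Kronecker product is the product of
  the two sums.

  This uses that a rational matrix has exactly one Moore--Penrose inverse
  (\<open>is_mp_inverse_exists\<close>, \<open>is_mp_inverse_unique\<close>).  Existence is reduced to that of a
  matrix \<open>G\<close> with \<open>M * G * M = M\<close>, which is linear algebra over any field; the passage from
  \<open>G\<close> to symmetric projections needs that a sum of squares of rationals vanishes only if every
  summand does.

  The objects of the product category are enumerated in an order that has nothing to do with the
  enumerations of the factors.  The Kronecker product is therefore formed for functions on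
  pairs of objects (\<open>kernel_tensor\<close>), where no enumeration is visible: once the Penrose
  equations are expressed by sums over the set of objects (\<open>is_mp_inverse_kernel_mat_iff\<close>),
  they hold for one enumeration if and only if they hold for every other.
\<close>

section \<open>Existence and uniqueness of the Moore--Penrose inverse\<close>

text \<open>
  With premises about dimensions in place of carriers, associativity becomes a conditional rewrite
  rule whose conditions the simplifier can discharge without guessing intermediate dimensions.
\<close>

lemma mult_mat_assoc_dim:
  assumes "dim_col A = dim_row B" and "dim_col B = dim_row C"
  shows "(A * B) * C = A * (B * (C :: 'a :: semiring_0 mat))"
  using assms by (intro assoc_mult_mat) auto

lemma sum_fun_apply: "sum f A x = (\<Sum>a\<in>A. f a x)"
  by (induction A rule: infinite_finite_induct) auto

text \<open>
  The linear map \<open>f\<close> given by \<open>M\<close> has a linear right inverse \<open>g\<close> on its range, and the matrix of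
  \<open>g\<close> is the desired \<open>G\<close>.  Vectors are taken to be arbitrary functions on the natural numbers, of
  which \<open>f\<close> reads only the first \<open>n\<close> coordinates: one vector space then serves as the domain
  and as the codomain, whatever \<open>m\<close> and \<open>n\<close> are.
\<close>

lemma generalized_inverse_exists:
  fixes M :: "rat mat"
  assumes M: "M \<in> carrier_mat m n"
  obtains G where "G \<in> carrier_mat n m" and "M * G * M = M"
proof -
  define scl :: "rat \<Rightarrow> (nat \<Rightarrow> rat) \<Rightarrow> nat \<Rightarrow> rat" where "scl c x = (\<lambda>i. c * x i)" for c x
  interpret V: vector_space scl
    by unfold_locales (auto simp: scl_def algebra_simps)
  interpret VV: vector_space_pair scl scl
    by unfold_locales
  have scl_apply: "scl c x i = c * x i" for c x i
    by (simp add: scl_def)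
  define f :: "(nat \<Rightarrow> rat) \<Rightarrow> nat \<Rightarrow> rat"
    where "f x = (\<lambda>i. if i < m then \<Sum>t<n. M $$ (i, t) * x t else 0)" for x
  define \<delta> :: "nat \<Rightarrow> nat \<Rightarrow> rat" where "\<delta> j = (\<lambda>i. if i = j then 1 else 0)" for j
  have "Vector_Spaces.linear scl scl f"
    by unfold_locales
      (auto simp: f_def scl_def fun_eq_iff algebra_simps sum.distrib sum_distrib_left)
  from VV.linear_exists_right_inverse_on[OF this V.subspace_UNIV]
  obtain g where "Vector_Spaces.linear scl scl g" and fg: "\<And>x. f (g (f x)) = f x"
    by blast
  then interpret g: Vector_Spaces.linear scl scl g by simp
  define G where "G = mat n m (\<lambda>(t, j). g (\<delta> j) t)"
  have f_\<delta>: "f (\<delta> t) = (\<Sum>j<m. scl (M $$ (j, t)) (\<delta> j))" if "t < n" for t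
    using that
    by (auto simp: fun_eq_iff f_def scl_apply \<delta>_def sum_fun_apply if_distrib[of "(*) _"]
        cong: if_cong)
  have f_\<delta>_nth: "f (\<delta> t) i = M $$ (i, t)" if "i < m" "t < n" for i t
    using that by (simp add: f_def \<delta>_def if_distrib[of "(*) _"] cong: if_cong)
  have gf_\<delta>: "g (f (\<delta> t)) s = (G * M) $$ (s, t)" if "t < n" "s < n" for s t
  proof -
    have "g (f (\<delta> t)) s = (\<Sum>j<m. M $$ (j, t) * g (\<delta> j) s)"
      using that by (simp add: f_\<delta> g.sum g.scale sum_fun_apply scl_apply)
    also have "\<dots> = (G * M) $$ (s, t)"
      using that M by (simp add: G_def scalar_prod_def atLeast0LessThan mult.commute)
    finally show ?thesis .
  qed
  have "(M * (G * M)) $$ (i, t) = M $$ (i, t)" if "i < m" "t < n" for i t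
  proof -
    have "(M * (G * M)) $$ (i, t) = (\<Sum>s<n. M $$ (i, s) * (G * M) $$ (s, t))"
      using that M by (auto simp: scalar_prod_def G_def atLeast0LessThan)
    also have "\<dots> = f (g (f (\<delta> t))) i"
      using that by (simp add: f_def[of "g _"] gf_\<delta>)
    also have "\<dots> = M $$ (i, t)"
      using that by (simp add: fg f_\<delta>_nth)
    finally show ?thesis .
  qed
  then have "M * (G * M) = M"
    using M by (intro eq_matI) (auto simp: G_def)
  then show ?thesis
    using M by (intro that[of G]) (auto simp: G_def mult_mat_assoc_dim)
qed

lemma gram_eq_zero_imp_eq_zero:
  fixes Y :: "rat mat"
  assumes Y: "Y \<in> carrier_mat m k" and zero: "transpose_mat Y * Y = 0\<^sub>m k k"
  shows "Y = 0\<^sub>m m k"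
proof (rule eq_matI)
  fix i j assume ij: "i < dim_row (0\<^sub>m m k)" "j < dim_col (0\<^sub>m m k)"
  have "(\<Sum>l<m. (Y $$ (l, j))\<^sup>2) = (transpose_mat Y * Y) $$ (j, j)"
    using ij Y by (auto simp: scalar_prod_def power2_eq_square atLeast0LessThan)
  also have "\<dots> = 0" using ij zero by simp
  finally show "Y $$ (i, j) = 0\<^sub>m m k $$ (i, j)"
    using ij by (subst (asm) sum_nonneg_eq_0_iff) auto
qed (use Y in auto)

text \<open>
  \<open>M\<close> and its Gram matrix have the same kernel: if the Gram matrix kills \<open>D\<close>, then
  \<open>M * D\<close> has Gram matrix zero and so vanishes itself.
\<close>

lemma gram_mult_cancel:
  fixes M :: "rat mat"
  assumes M: "M \<in> carrier_mat m n" and Z: "Z \<in> carrier_mat n k" and W: "W \<in> carrier_mat n k"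
    and eq: "transpose_mat M * M * Z = transpose_mat M * M * W"
  shows "M * Z = M * W"
proof -
  define D where "D = Z - W"
  have D: "D \<in> carrier_mat n k" unfolding D_def using W by (rule minus_carrier_mat)
  have MD: "M * D = M * Z - M * W"
    unfolding D_def using M Z W by (intro mult_minus_distrib_mat)
  have "transpose_mat M * M * D = 0\<^sub>m n k"
    unfolding D_def using M Z W eq
    by (subst mult_minus_distrib_mat[where nr = n and n = n and nc = k]) auto
  then have "transpose_mat (M * D) * (M * D) = 0\<^sub>m k k"
    using M D by (simp add: transpose_mult[OF M D] mult_mat_assoc_dim)
  then have "M * D = 0\<^sub>m m k"
    using gram_eq_zero_imp_eq_zero[of "M * D" m k] M D by simp
  then have "M * Z - M * W = 0\<^sub>m m k"
    by (simp only: MD)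
  moreover have "M * Z = (M * Z - M * W) + M * W"
    using M Z W by (intro eq_matI) auto
  moreover have "0\<^sub>m m k + M * W = M * W"
    using M W by (intro left_add_zero_mat mult_carrier_mat)
  ultimately show ?thesis
    by simp
qed

text \<open>
  Write \<open>T\<close> for the transpose of \<open>M\<close>.  If \<open>G\<close> is a generalized inverse of the Gram matrix
  \<open>T * M\<close>, then \<open>X = G * T\<close> works.  Cancelling the Gram factor in \<open>T * M * G * T * M = T * M\<close>
  leaves \<open>P * M = M\<close> for \<open>P = M * G * T\<close>.  The transpose of this equation reads
  \<open>T * P\<^sup>T = T\<close>, whence \<open>P * P\<^sup>T = P\<close>, and the left side is symmetric.
\<close>

lemma least_squares_inverse_exists:
  fixes M :: "rat mat"
  assumes M: "M \<in> carrier_mat m n"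
  obtains X where "X \<in> carrier_mat n m" and "M * X * M = M"
    and "transpose_mat (M * X) = M * X"
proof -
  define T where "T = transpose_mat M"
  have T: "T \<in> carrier_mat n m" using M by (simp add: T_def)
  obtain G where G: "G \<in> carrier_mat n n" and inv: "(T * M) * G * (T * M) = T * M"
    using generalized_inverse_exists[of "T * M" n n] M T by auto
  define P where "P = M * (G * T)"
  have P: "P \<in> carrier_mat m m" using M T G by (auto simp: P_def)
  have "M * (G * T * M) = M * 1\<^sub>m n"
  proof (rule gram_mult_cancel)
    show "transpose_mat M * M * (G * T * M) = transpose_mat M * M * 1\<^sub>m n"
      using inv M T G unfolding T_def[symmetric] by (simp add: mult_mat_assoc_dim)
  qed (use M T G in auto)
  then have PM: "P * M = M"
    using M T G by (simp add: P_def mult_mat_assoc_dim)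
  have "T * transpose_mat P = T"
    using PM transpose_mult[OF P M] by (simp add: T_def)
  then have PP: "P * transpose_mat P = P"
    using M T G P unfolding P_def by (simp add: mult_mat_assoc_dim)
  have "transpose_mat P = P"
    using transpose_mult[of P m m "transpose_mat P" m] P by (simp add: PP)
  then show ?thesis
    using PM M T G by (intro that[of "G * T"]) (auto simp: P_def)
qed

text \<open>
  If \<open>X\<close> and \<open>Y\<close> are generalized inverses of \<open>M\<close> such that \<open>M * X\<close> and \<open>Y * M\<close> are
  symmetric, then \<open>N = Y * M * X\<close> satisfies \<open>M * N = M * X\<close> and \<open>N * M = Y * M\<close>, so it
  inherits both symmetries.  Such a \<open>Y\<close> is the transpose of a least squares inverse of the
  transpose of \<open>M\<close>.
\<close>

lemma is_mp_inverse_exists: "\<exists>N. is_mp_inverse M N"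
proof -
  define m n where "m = dim_row M" and "n = dim_col M"
  have M: "M \<in> carrier_mat m n" by (simp add: m_def n_def)
  obtain X where X: "X \<in> carrier_mat n m" "M * X * M = M" "transpose_mat (M * X) = M * X"
    using least_squares_inverse_exists[OF M] .
  have MT: "transpose_mat M \<in> carrier_mat n m" using M by simp
  obtain Y' where Y': "Y' \<in> carrier_mat m n" "transpose_mat M * Y' * transpose_mat M = transpose_mat M"
      "transpose_mat (transpose_mat M * Y') = transpose_mat M * Y'"
    using least_squares_inverse_exists[OF MT] .
  define Y where "Y = transpose_mat Y'"
  have Y: "Y \<in> carrier_mat n m" using Y' by (simp add: Y_def)
  have YM: "transpose_mat (transpose_mat M * Y') = Y * M"
    using transpose_mult[OF MT Y'(1)] by (simp add: Y_def)
  have YM_sym: "transpose_mat (Y * M) = Y * M"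
    using Y'(3) YM by simp
  have MYM: "M * (Y * M) = M"
  proof -
    have "transpose_mat (transpose_mat M * Y' * transpose_mat M) = M * (Y * M)"
      using transpose_mult[of "transpose_mat M * Y'" n n "transpose_mat M" m] M Y'(1) YM by simp
    then show ?thesis using Y'(2) by simp
  qed
  define N where "N = Y * (M * X)"
  have N: "N \<in> carrier_mat n m" using M X Y by (auto simp: N_def)
  have MN: "M * N = M * X"
  proof -
    have "M * N = (M * (Y * M)) * X" using M X(1) Y by (simp add: N_def mult_mat_assoc_dim)
    then show ?thesis by (simp add: MYM)
  qed
  have NM: "N * M = Y * M"
  proof -
    have "N * M = Y * (M * X * M)" using M X(1) Y by (simp add: N_def mult_mat_assoc_dim)
    then show ?thesis by (simp add: X)
  qed
  have "Y * M * N = N"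
  proof -
    have "Y * M * N = Y * ((M * (Y * M)) * X)" using M X(1) Y by (simp add: N_def mult_mat_assoc_dim)
    then show ?thesis by (simp add: MYM N_def)
  qed
  then have "is_mp_inverse M N"
    using N X YM_sym by (simp add: is_mp_inverse_def MN NM m_def n_def)
  then show ?thesis ..
qed

text \<open>
  For two Moore--Penrose inverses \<open>N\<close> and \<open>L\<close>, the symmetric idempotents \<open>M * N\<close> and \<open>M * L\<close>
  absorb each other from the left, since both fix \<open>M\<close>.  Transposing one of these absorption laws
  shows that they are equal; likewise \<open>N * M = L * M\<close>, and so \<open>N = N * M * N = L * M * L = L\<close>.
\<close>

lemma is_mp_inverse_unique:
  assumes N: "is_mp_inverse M N" and L: "is_mp_inverse M L"
  shows "N = L"
proof -
  define m n where "m = dim_row M" and "n = dim_col M"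
  have M: "M \<in> carrier_mat m n" by (simp add: m_def n_def)
  have Nc: "N \<in> carrier_mat n m" and Lc: "L \<in> carrier_mat n m"
    using N L by (auto simp: is_mp_inverse_def m_def n_def)
  note eqs = N[unfolded is_mp_inverse_def] L[unfolded is_mp_inverse_def]
  have "M * N = (M * L * M) * N" using eqs by simp
  also have "\<dots> = (M * L) * (M * N)" using M Nc Lc by (simp add: mult_mat_assoc_dim)
  also have "\<dots> = transpose_mat ((M * N) * (M * L))"
    using transpose_mult[of "M * N" m m "M * L" m] M Nc Lc eqs by simp
  also have "(M * N) * (M * L) = (M * N * M) * L" using M Nc Lc by (simp add: mult_mat_assoc_dim)
  also have "transpose_mat \<dots> = M * L" using eqs by simp
  finally have MN: "M * N = M * L" .
  have "N * M = N * (M * L * M)" using eqs by simp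
  also have "\<dots> = (N * M) * (L * M)" using M Nc Lc by (simp add: mult_mat_assoc_dim)
  also have "\<dots> = transpose_mat ((L * M) * (N * M))"
    using transpose_mult[of "L * M" n n "N * M" n] M Nc Lc eqs by simp
  also have "(L * M) * (N * M) = L * (M * N * M)" using M Nc Lc by (simp add: mult_mat_assoc_dim)
  also have "transpose_mat \<dots> = L * M" using eqs by simp
  finally have NM: "N * M = L * M" .
  have "N = N * M * N" using eqs by simp
  also have "\<dots> = L * (M * N)" using M Nc Lc by (simp add: NM mult_mat_assoc_dim)
  also have "\<dots> = L * M * L" using M Nc Lc by (simp add: MN mult_mat_assoc_dim)
  also have "\<dots> = L" using eqs by simp
  finally show ?thesis .
qed

lemma mp_inverse_eqI: "is_mp_inverse M N \<Longrightarrow> mp_inverse M = N"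
  unfolding mp_inverse_def by (blast intro: the_equality is_mp_inverse_unique)

lemma is_mp_inverse_mp_inverse: "is_mp_inverse M (mp_inverse M)"
  using is_mp_inverse_exists mp_inverse_eqI by metis

section \<open>Matrices indexed by the entries of a list\<close>

text \<open>
  A function \<open>F\<close> of two arguments is a matrix whose rows and columns are indexed by a set; a list
  without repetitions that enumerates the set turns it into an ordinary matrix.  Products,
  transposes and the sum of the entries can be computed before the list is chosen.
\<close>

definition kernel_mat :: "'a list \<Rightarrow> ('a \<Rightarrow> 'a \<Rightarrow> rat) \<Rightarrow> rat mat" where
  "kernel_mat xs F = mat (length xs) (length xs) (\<lambda>(i, j). F (xs ! i) (xs ! j))"

definition kernel_comp :: "'a set \<Rightarrow> ('a \<Rightarrow> 'a \<Rightarrow> rat) \<Rightarrow> ('a \<Rightarrow> 'a \<Rightarrow> rat) \<Rightarrow> 'a \<Rightarrow> 'a \<Rightarrow> rat" where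
  "kernel_comp S F G = (\<lambda>a b. \<Sum>c\<in>S. F a c * G c b)"

definition kernel_tensor ::
  "('a \<Rightarrow> 'a \<Rightarrow> rat) \<Rightarrow> ('b \<Rightarrow> 'b \<Rightarrow> rat) \<Rightarrow> 'a \<times> 'b \<Rightarrow> 'a \<times> 'b \<Rightarrow> rat" where
  "kernel_tensor F G = (\<lambda>p q. F (fst p) (fst q) * G (snd p) (snd q))"

lemma sum_nth_distinct:
  assumes "distinct xs"
  shows "(\<Sum>i<length xs. f (xs ! i)) = sum f (set xs)"
  using sum.reindex_bij_betw[OF bij_betw_nth[OF assms refl refl]] .

lemma kernel_mat_carrier: "kernel_mat xs F \<in> carrier_mat (length xs) (length xs)"
  by (simp add: kernel_mat_def)

lemma kernel_mat_surj:
  assumes "distinct xs" and N: "N \<in> carrier_mat (length xs) (length xs)"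
  obtains F where "N = kernel_mat xs F"
proof
  define pos where "pos = inv_into {..<length xs} ((!) xs)"
  have "pos (xs ! i) = i" if "i < length xs" for i
    unfolding pos_def using that assms(1) by (intro inv_into_f_f) (auto simp: inj_on_nth)
  then show "N = kernel_mat xs (\<lambda>a b. N $$ (pos a, pos b))"
    using N by (intro eq_matI) (auto simp: kernel_mat_def)
qed

lemma kernel_mat_eq_iff:
  "kernel_mat xs F = kernel_mat xs G \<longleftrightarrow> (\<forall>a\<in>set xs. \<forall>b\<in>set xs. F a b = G a b)"
  by (auto simp: kernel_mat_def mat_eq_iff all_set_conv_all_nth)

lemma kernel_mat_mult:
  assumes "distinct xs"
  shows "kernel_mat xs F * kernel_mat xs G = kernel_mat xs (kernel_comp (set xs) F G)"
proof (rule eq_matI)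
  fix i j
  assume "i < dim_row (kernel_mat xs (kernel_comp (set xs) F G))"
    and "j < dim_col (kernel_mat xs (kernel_comp (set xs) F G))"
  then have ij: "i < length xs" "j < length xs"
    by (simp_all add: kernel_mat_def)
  have "(kernel_mat xs F * kernel_mat xs G) $$ (i, j)
      = (\<Sum>k<length xs. F (xs ! i) (xs ! k) * G (xs ! k) (xs ! j))"
    using ij by (simp add: kernel_mat_def scalar_prod_def atLeast0LessThan)
  also have "\<dots> = (\<Sum>c\<in>set xs. F (xs ! i) c * G c (xs ! j))"
    by (rule sum_nth_distinct[OF assms])
  finally show "(kernel_mat xs F * kernel_mat xs G) $$ (i, j)
      = kernel_mat xs (kernel_comp (set xs) F G) $$ (i, j)"
    using ij by (simp add: kernel_mat_def kernel_comp_def)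
qed (simp_all add: kernel_mat_def)

lemma transpose_kernel_mat: "transpose_mat (kernel_mat xs F) = kernel_mat xs (\<lambda>a b. F b a)"
  by (intro eq_matI) (auto simp: kernel_mat_def)

lemma sum_entries_kernel_mat:
  assumes "distinct xs" and "length xs = n"
  shows "(transpose_mat (ones_mat n) * kernel_mat xs F * ones_mat n) $$ (0, 0)
    = (\<Sum>a\<in>set xs. \<Sum>b\<in>set xs. F a b)"
proof -
  have "(transpose_mat (ones_mat n) * kernel_mat xs F * ones_mat n) $$ (0, 0)
      = (\<Sum>j<n. \<Sum>i<n. F (xs ! i) (xs ! j))"
    using assms(2) by (auto simp: ones_mat_def kernel_mat_def scalar_prod_def atLeast0LessThan)
  also have "\<dots> = (\<Sum>i<n. \<Sum>j<n. F (xs ! i) (xs ! j))"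
    by (rule sum.swap)
  also have "\<dots> = (\<Sum>a\<in>set xs. \<Sum>b\<in>set xs. F a b)"
    using assms by (simp flip: sum_nth_distinct[OF assms(1)])
  finally show ?thesis .
qed

definition is_mp_kernel :: "'a set \<Rightarrow> ('a \<Rightarrow> 'a \<Rightarrow> rat) \<Rightarrow> ('a \<Rightarrow> 'a \<Rightarrow> rat) \<Rightarrow> bool" where
  "is_mp_kernel S F G \<longleftrightarrow> (\<forall>a\<in>S. \<forall>b\<in>S.
     kernel_comp S (kernel_comp S F G) F a b = F a b \<and>
     kernel_comp S (kernel_comp S G F) G a b = G a b \<and>
     kernel_comp S G F b a = kernel_comp S G F a b \<and>
     kernel_comp S F G b a = kernel_comp S F G a b)"

text \<open>
  The right side mentions the list only through its set of entries.  This is the independence of the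
  order of the objects.
\<close>

lemma is_mp_inverse_kernel_mat_iff:
  assumes "distinct xs"
  shows "is_mp_inverse (kernel_mat xs F) (kernel_mat xs G) \<longleftrightarrow> is_mp_kernel (set xs) F G"
  using kernel_mat_carrier[of xs F] kernel_mat_carrier[of xs G]
  by (auto simp: is_mp_inverse_def is_mp_kernel_def kernel_mat_mult[OF assms]
      transpose_kernel_mat kernel_mat_eq_iff)

section \<open>Kronecker products\<close>

text \<open>
  The mixed-product rule for Kronecker products.
\<close>

lemma kernel_comp_tensor:
  "kernel_comp (S \<times> T) (kernel_tensor F F') (kernel_tensor G G')
    = kernel_tensor (kernel_comp S F G) (kernel_comp T F' G')"
  by (simp add: fun_eq_iff kernel_comp_def kernel_tensor_def sum_product sum.cartesian_product'
      mult_ac)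

lemma is_mp_kernel_tensor:
  assumes "is_mp_kernel S F G" and "is_mp_kernel T F' G'"
  shows "is_mp_kernel (S \<times> T) (kernel_tensor F F') (kernel_tensor G G')"
  using assms unfolding is_mp_kernel_def kernel_comp_tensor
  by (auto simp: kernel_tensor_def)

lemma sum_kernel_tensor:
  "(\<Sum>p\<in>S \<times> T. \<Sum>q\<in>S \<times> T. kernel_tensor F G p q)
    = (\<Sum>a\<in>S. \<Sum>b\<in>S. F a b) * (\<Sum>a\<in>T. \<Sum>b\<in>T. G a b)"
proof -
  have "(\<Sum>p\<in>S \<times> T. \<Sum>q\<in>S \<times> T. kernel_tensor F G p q)
      = (\<Sum>a\<in>S. \<Sum>c\<in>T. \<Sum>b\<in>S. \<Sum>d\<in>T. F a b * G c d)"
    by (simp add: kernel_tensor_def sum.cartesian_product')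
  also have "\<dots> = (\<Sum>a\<in>S. \<Sum>b\<in>S. F a b) * (\<Sum>c\<in>T. \<Sum>d\<in>T. G c d)"
    by (simp only: sum_product)
  finally show ?thesis .
qed

section \<open>The Euler characteristic of a product category\<close>

definition hom_count :: "('o, 'm) cat_struct \<Rightarrow> 'o \<Rightarrow> 'o \<Rightarrow> rat" where
  "hom_count C a b = of_nat (card (homset C a b))"

lemma hom_count_prod_cat:
  "hom_count (prod_cat C D) = kernel_tensor (hom_count C) (hom_count D)"
  by (simp add: fun_eq_iff hom_count_def kernel_tensor_def homset_prod_cat card_cartesian_product)

lemma obj_enum:
  assumes "finite (obs C)"
  shows "distinct (obj_enum C)" and "set (obj_enum C) = obs C"
proof -
  have "\<exists>as. distinct as \<and> set as = obs C"
    using finite_distinct_list[OF assms] by blast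
  from someI_ex[OF this] show "distinct (obj_enum C)" and "set (obj_enum C) = obs C"
    unfolding obj_enum_def by simp_all
qed

lemma hom_mat_eq_kernel_mat:
  assumes "finite (obs C)"
  shows "hom_mat C = kernel_mat (obj_enum C) (hom_count C)"
  using distinct_card[OF obj_enum(1)[OF assms]]
  by (simp add: hom_mat_def kernel_mat_def hom_count_def obj_enum(2)[OF assms])

lemma mp_kernel_hom_count_exists:
  assumes "finite (obs C)"
  obtains G where "is_mp_kernel (obs C) (hom_count C) G"
proof -
  let ?xs = "obj_enum C" and ?N = "mp_inverse (hom_mat C)"
  have "?N \<in> carrier_mat (length ?xs) (length ?xs)"
    using is_mp_inverse_mp_inverse[of "hom_mat C"]
    by (simp add: is_mp_inverse_def hom_mat_eq_kernel_mat[OF assms] kernel_mat_def)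
  then obtain G where "?N = kernel_mat ?xs G"
    using kernel_mat_surj[OF obj_enum(1)[OF assms]] by blast
  then show ?thesis
    using is_mp_inverse_mp_inverse[of "hom_mat C"] that
    by (simp add: hom_mat_eq_kernel_mat[OF assms] obj_enum[OF assms]
        is_mp_inverse_kernel_mat_iff)
qed

text \<open>
  Any \<open>G\<close> that satisfies the Penrose equations may be used here, by uniqueness.  For the product
  category this allows the tensor product of the inverses for the factors.
\<close>

lemma euler_char_eq_sum:
  assumes fin: "finite (obs C)" and G: "is_mp_kernel (obs C) (hom_count C) G"
  shows "euler_char C = (\<Sum>a\<in>obs C. \<Sum>b\<in>obs C. G a b)"
proof -
  have "is_mp_inverse (hom_mat C) (kernel_mat (obj_enum C) G)"
    using G by (simp add: hom_mat_eq_kernel_mat[OF fin] obj_enum[OF fin]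
        is_mp_inverse_kernel_mat_iff)
  then have "mp_inverse (hom_mat C) = kernel_mat (obj_enum C) G"
    by (rule mp_inverse_eqI)
  moreover have "length (obj_enum C) = card (obs C)"
    using distinct_card[OF obj_enum(1)[OF fin]] by (simp add: obj_enum(2)[OF fin])
  ultimately show ?thesis
    by (simp add: euler_char_def sum_entries_kernel_mat obj_enum[OF fin])
qed

theorem theorem2p16:
  fixes A :: "('o1, 'm1) cat_struct" and B :: "('o2, 'm2) cat_struct"
  assumes "finite_category A" and "finite_category B"
  shows "euler_char (prod_cat A B) = euler_char A * euler_char B"
proof -
  have fin: "finite (obs A)" "finite (obs B)"
    using assms by (auto dest: finite_category.finite_obs)
  obtain G where G: "is_mp_kernel (obs A) (hom_count A) G"
    using mp_kernel_hom_count_exists[OF fin(1)] .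
  obtain H where H: "is_mp_kernel (obs B) (hom_count B) H"
    using mp_kernel_hom_count_exists[OF fin(2)] .
  have obs_prod: "obs (prod_cat A B) = obs A \<times> obs B"
    by (simp add: prod_cat_def)
  have "is_mp_kernel (obs (prod_cat A B)) (hom_count (prod_cat A B)) (kernel_tensor G H)"
    using is_mp_kernel_tensor[OF G H] by (simp add: obs_prod hom_count_prod_cat)
  moreover have "finite (obs (prod_cat A B))"
    using fin by (simp add: obs_prod)
  ultimately have "euler_char (prod_cat A B)
      = (\<Sum>p\<in>obs A \<times> obs B. \<Sum>q\<in>obs A \<times> obs B. kernel_tensor G H p q)"
    by (simp only: euler_char_eq_sum obs_prod)
  also have "\<dots> = euler_char A * euler_char B"
    by (simp add: sum_kernel_tensor euler_char_eq_sum[OF fin(1) G] euler_char_eq_sum[OF fin(2) H])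
  finally show ?thesis .
qed

end
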